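(* Let $b\geq 2$ be an integer and let $M\in\mathcal{M}_b(\mathbf{P_1})$. Then $\sharp A^{\mathbb{N}}_M=2^{b-1}$ if and only if $M$ is equivalent with one of the following three $b\times b$ matrices (in block form): $$\begin{pmatrix}1&\mathbf{0}\\ \mathbf{1}&L_{b-1}\end{pmatrix},\qquad \begin{pmatrix}I_2&\mathbf{0}\\ \mathbf{1}&L_{b-2}\end{pmatrix},\qquad \begin{pmatrix}J_2&\mathbf{0}\\ \mathbf{1}&L_{b-2}\end{pmatrix}.$$
   Context: $\mathbb{N}$ is the set of positive integers, $A=\{1,2,\dots,b\}$, and $\sharp$ denotes cardinality. $\mathcal{M}_b$ is the family of nonzero $b\times b$ matrices with entries in $\{0,1\}$; $r_i(M)$ and $c_j(M)$ denote the $i$-th row and $j$-th column of $M$. A matrix $M\in\mathcal{M}_b$ satisfies condition $\mathbf{P_1}$ if $r_i(M)\neq\mathbf{0}$ for every $i\in\{j\in A: c_j(M)\neq\mathbf{0}\}$; $\mathcal{M}_b(\mathbf{P_1})$ is the set of all $M\in\mathcal{M}_b$ satisfying $\mathbf{P_1}$. $A^{\mathbb{N}}$ is the set of infinite words over $A$, and $A^{\mathbb{N}}_M=\{w\in A^{\mathbb{N}}: M_{w_kw_{k+1}}=1\text{ for all }k\in\mathbb{N}\}$. $\mathbf{1}$ denotes a matrix (of the size dictated by the block structure) all of whose entries are $1$, and $\mathbf{0}$ a zero matrix. $L_k$ is the $k\times k$ matrix whose $(i,j)$ entry is $1$ if $i>j$ and $0$ otherwise. $I_k$ is the $k\times k$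 identity matrix. $J_2=\begin{pmatrix}0&1\\1&0\end{pmatrix}$. In the case $b=2$, the three matrices are $\begin{pmatrix}1&0\\1&0\end{pmatrix}$, $I_2$, $J_2$, respectively. Matrices $M,N\in\mathcal{M}_b$ are equivalent, written $M\sim N$, if there exist pairs $(i_1,j_1),\dots,(i_l,j_l)\in A\times A$ such that $M=P(i_l,j_l)\cdots P(i_1,j_1)\,N\,P(i_1,j_1)\cdots P(i_l,j_l)$, where $P(i,j)$ is the matrix obtained by interchanging the $i$-th and $j$-th rows of $I_b$. *)

theory Defs
  imports "Jordan_Normal_Form.Gauss_Jordan_Elimination"
begin

text \<open>Matrix indices start at 0 in the library, so the alphabet {1,...,b} is represented
  by {0,...,b-1} (letter a is represented by a - 1), and the positions of an infinite word are
  likewise numbered from 0 instead of 1.\<close>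

definition alphabet :: "nat \<Rightarrow> nat set" where
  "alphabet b = {0..<b}"

definition zero_one_mats :: "nat \<Rightarrow> int mat set" where
  "zero_one_mats b =
     {M \<in> carrier_mat b b. M \<noteq> 0\<^sub>m b b \<and> (\<forall>i<b. \<forall>j<b. M $$ (i, j) \<in> {0, 1})}"

definition P1 :: "nat \<Rightarrow> int mat \<Rightarrow> bool" where
  "P1 b M \<longleftrightarrow> (\<forall>i \<in> {j \<in> alphabet b. col M j \<noteq> 0\<^sub>v b}. row M i \<noteq> 0\<^sub>v b)"

definition zero_one_mats_P1 :: "nat \<Rightarrow> int mat set" where
  "zero_one_mats_P1 b = {M \<in> zero_one_mats b. P1 b M}"

definition infinite_words :: "nat \<Rightarrow> (nat \<Rightarrow> nat) set" where
  "infinite_words b = {w. \<forall>k. w k \<in> alphabet b}"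

definition admissible_words :: "nat \<Rightarrow> int mat \<Rightarrow> (nat \<Rightarrow> nat) set" where
  "admissible_words b M = {w \<in> infinite_words b. \<forall>k. M $$ (w k, w (Suc k)) = 1}"

definition swap_mat :: "nat \<Rightarrow> nat \<times> nat \<Rightarrow> int mat" where
  "swap_mat b = (\<lambda>(i, j). swaprows i j (1\<^sub>m b))"

definition mat_list_prod :: "nat \<Rightarrow> int mat list \<Rightarrow> int mat" where
  "mat_list_prod b Qs = foldr (*) Qs (1\<^sub>m b)"

text \<open>The list \<open>ps\<close> is (i_1,j_1), ..., (i_l,j_l). The empty list is harmless: it gives M = N,
  which also arises from any pair (i,i).\<close>

definition mat_equiv :: "nat \<Rightarrow> int mat \<Rightarrow> int mat \<Rightarrow> bool" where
  "mat_equiv b M N \<longleftrightarrow> M \<in> zero_one_mats b \<and> N \<in> zero_one_mats b \<and>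
     (\<exists>ps. set ps \<subseteq> alphabet b \<times> alphabet b \<and>
        M = mat_list_prod b (map (swap_mat b) (rev ps)) * N
              * mat_list_prod b (map (swap_mat b) ps))"

definition ones_mat :: "nat \<Rightarrow> nat \<Rightarrow> int mat" where
  "ones_mat m n = mat m n (\<lambda>_. 1)"

definition L_mat :: "nat \<Rightarrow> int mat" where
  "L_mat k = mat k k (\<lambda>(i, j). if i > j then 1 else 0)"

definition J2_mat :: "int mat" where
  "J2_mat = mat_of_rows_list 2 [[0, 1], [1, 0]]"

end

theory Submission
  imports Defs "HOL-Combinatorics.Permutations"
begin

text \<open>View \<open>M\<close> as the adjacency relation \<open>E\<close> of a digraph, so that admissible words are infinite
  walks. Take a nonempty vertex set \<open>S\<close> that is closed under successors and carries finitely many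
  walks. If every vertex of \<open>S\<close> has a predecessor in \<open>S\<close>, prepending a chosen predecessor is an
  injection of a finite set of walks into itself, hence a bijection; this forces \<open>E\<close> to be a
  permutation of \<open>S\<close>, and there are \<open>card S \<le> 2 ^ (card S - 1)\<close> walks, with equality only for
  \<open>card S \<le> 2\<close>. Otherwise remove a vertex \<open>v\<close> without predecessor: the walks from \<open>v\<close>
  correspond to walks in the rest, so the count at most doubles, and it doubles exactly when
  \<open>v\<close> points to every other vertex. Hence the extremal graphs are staircases built on
  a loop, two loops or a 2-cycle.\<close>

section \<open>Infinite walks\<close>

text \<open>Only the start is constrained, so that tails of walks from \<open>v\<close> are simply
  walks from the successors of \<open>v\<close>. If \<open>S\<close> is closed under successors, the
  whole walk stays in \<open>S\<close>.\<close>

definition walks :: "('a \<Rightarrow> 'a \<Rightarrow> bool) \<Rightarrow> 'a set \<Rightarrow> (nat \<Rightarrow> 'a) set" where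
  "walks E S = {w. w 0 \<in> S \<and> (\<forall>k. E (w k) (w (Suc k)))}"

lemma walks_singleton: "walks E {v} = case_nat v ` walks E {u. E v u}"
proof (intro equalityI subsetI)
  fix w assume w: "w \<in> walks E {v}"
  then have "w = case_nat v (\<lambda>k. w (Suc k))"
    by (auto simp: walks_def fun_eq_iff split: nat.split)
  moreover have "(\<lambda>k. w (Suc k)) \<in> walks E {u. E v u}"
    using w by (auto simp: walks_def)
  ultimately show "w \<in> case_nat v ` walks E {u. E v u}" by blast
qed (auto simp: walks_def split: nat.split)

lemma inj_case_nat: "inj (case_nat v)"
proof (rule injI)
  fix w w' :: "nat \<Rightarrow> 'a"
  assume eq: "case_nat v w = case_nat v w'"
  show "w = w'"
  proof
    fix k show "w k = w' k" using fun_cong[OF eq, of "Suc k"] by simp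
  qed
qed

lemma card_walks_singleton: "card (walks E {v}) = card (walks E {u. E v u})"
  unfolding walks_singleton by (intro card_image inj_on_subset[OF inj_case_nat]) simp

lemma finite_walks_singleton: "finite (walks E {v}) \<longleftrightarrow> finite (walks E {u. E v u})"
  unfolding walks_singleton by (intro finite_image_iff inj_on_subset[OF inj_case_nat]) simp

lemma walks_mono: "S \<subseteq> T \<Longrightarrow> walks E S \<subseteq> walks E T"
  by (auto simp: walks_def)

lemma walks_insert: "walks E (insert v S) = walks E {v} \<union> walks E S"
  by (auto simp: walks_def)

lemma walks_disjoint: "v \<notin> S \<Longrightarrow> walks E {v} \<inter> walks E S = {}"
  by (auto simp: walks_def)

text \<open>Walks split by their first vertex, and deleting it turns the walks from \<open>v\<close>
  into walks from its successors. This recursion drives both the bound and the exact count.\<close>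

lemma card_walks_insert:
  assumes "v \<notin> S" "finite (walks E S)" "finite (walks E {u. E v u})"
  shows "card (walks E (insert v S)) = card (walks E {u. E v u}) + card (walks E S)"
proof -
  have "card (walks E (insert v S)) = card (walks E {v}) + card (walks E S)"
    using assms by (subst walks_insert, intro card_Un_disjoint)
      (simp_all add: walks_disjoint finite_walks_singleton)
  then show ?thesis by (simp only: card_walks_singleton)
qed

text \<open>A walk consists of the iterates of \<open>g\<close> at its start. This counts walks both
  for permutations and for the base of a staircase.\<close>

lemma walks_unique_successor:
  assumes "\<And>u v. u \<in> S \<Longrightarrow> E u v \<longleftrightarrow> v = g u" and "\<And>u. u \<in> S \<Longrightarrow> g u \<in> S"
  shows "bij_betw (\<lambda>v k. (g ^^ k) v) S (walks E S)"
proof (rule bij_betw_imageI)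
  show "inj_on (\<lambda>v k. (g ^^ k) v) S"
  proof (rule inj_onI)
    fix u v assume "(\<lambda>k. (g ^^ k) u) = (\<lambda>k. (g ^^ k) v)"
    from fun_cong[OF this, of 0] show "u = v" by simp
  qed
  have mem: "(g ^^ k) v \<in> S" if "v \<in> S" for k v
    using that assms(2) by (induction k) auto
  show "(\<lambda>v k. (g ^^ k) v) ` S = walks E S"
  proof (intro equalityI subsetI)
    fix w assume "w \<in> (\<lambda>v k. (g ^^ k) v) ` S"
    then show "w \<in> walks E S" using mem assms(1) by (auto simp: walks_def)
  next
    fix w assume w: "w \<in> walks E S"
    have "w k = (g ^^ k) (w 0)" for k
    proof (induction k)
      case (Suc k)
      have "w 0 \<in> S" "E (w k) (w (Suc k))" using w by (auto simp: walks_def)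
      with Suc mem[of "w 0" k] assms(1)[of "w k"] show ?case by simp
    qed simp
    then have "w = (\<lambda>k. (g ^^ k) (w 0))" by blast
    moreover have "w 0 \<in> S" using w by (auto simp: walks_def)
    ultimately show "w \<in> (\<lambda>v k. (g ^^ k) v) ` S" by blast
  qed
qed

section \<open>Existence of walks, and graphs without sources\<close>

lemma walks_nonempty:
  assumes "E v u" "\<And>x y. E x y \<Longrightarrow> \<exists>z. E y z"
  shows "walks E {v} \<noteq> {}"
proof -
  \<comment> \<open>A chosen successor; its value at a dead end is arbitrary, and the iterates from
    \<open>v\<close> never reach one.\<close>
  obtain s where s: "\<And>x. \<exists>y. E x y \<Longrightarrow> E x (s x)"
    by (rule that[of "\<lambda>x. SOME y. E x y"]) (rule someI_ex)
  have "E ((s ^^ k) v) ((s ^^ Suc k) v)" for k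
  proof (induction k)
    case 0 then show ?case using assms(1) s by auto
  next
    case (Suc k)
    from assms(2)[OF Suc] s show ?case by (metis funpow.simps(2) o_apply)
  qed
  then have "(\<lambda>k. (s ^^ k) v) \<in> walks E {v}" by (auto simp: walks_def)
  then show ?thesis by blast
qed

text \<open>Finiteness of the set of walks makes the injective prepending map surjective. A
  predecessor of \<open>v\<close> in \<open>S\<close> other than the chosen \<open>p v\<close> would
  begin a walk outside its image. So \<open>p\<close> permutes \<open>S\<close>, and
  \<open>g\<close> is its inverse.\<close>

lemma sourceless_permutation:
  assumes fin: "finite S" "finite (walks E S)"
    and closed: "\<And>u v. u \<in> S \<Longrightarrow> E u v \<Longrightarrow> v \<in> S"
    and extend: "\<And>x y. E x y \<Longrightarrow> \<exists>z. E y z"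
    and source: "\<And>v. v \<in> S \<Longrightarrow> \<exists>u\<in>S. E u v"
  obtains g where "bij_betw g S S" "\<And>u v. u \<in> S \<Longrightarrow> E u v \<longleftrightarrow> v = g u"
proof -
  obtain p where p: "\<And>v. v \<in> S \<Longrightarrow> p v \<in> S \<and> E (p v) v"
    using source by metis
  let ?pre = "\<lambda>w. case_nat (p (w 0)) w"
  have "inj_on ?pre (walks E S)"
  proof (rule inj_onI)
    fix w w' assume eq: "?pre w = ?pre w'"
    show "w = w'"
    proof
      fix k show "w k = w' k" using fun_cong[OF eq, of "Suc k"] by simp
    qed
  qed
  moreover have "?pre ` walks E S \<subseteq> walks E S"
    using p by (auto simp: walks_def split: nat.split)
  ultimately have surj: "?pre ` walks E S = walks E S"
    using fin(2) by (simp add: endo_inj_surj)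
  have pred: "u = p v" if uv: "u \<in> S" "E u v" for u v
  proof -
    obtain z where "E v z" using extend uv(2) by blast
    then obtain w where w: "w \<in> walks E {v}" using walks_nonempty[of E v z] extend by blast
    then have "case_nat u w \<in> walks E S" using uv by (auto simp: walks_def split: nat.split)
    then obtain w' where "case_nat u w = ?pre w'" using surj by blast
    \<comment> \<open>Entry 1 gives \<open>w' 0 = w 0 = v\<close>, and then entry 0 gives
      \<open>u = p (w' 0) = p v\<close>.\<close>
    from fun_cong[OF this, of 0] fun_cong[OF this, of 1] w show ?thesis
      by (auto simp: walks_def)
  qed
  have "S \<subseteq> p ` S"
  proof
    fix u assume u: "u \<in> S"
    \<comment> \<open>A successor exists because \<open>u\<close> is itself the head of an edge, as
      \<open>extend\<close> requires.\<close>
    then obtain v where "E u v" using source extend by blast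
    with u closed pred show "u \<in> p ` S" by blast
  qed
  with p have img: "p ` S = S" by blast
  then have inj: "inj_on p S" using fin(1) by (simp add: eq_card_imp_inj_on)
  show thesis
  proof
    show "bij_betw (inv_into S p) S S" using img inj by (intro bij_betw_inv_into) (simp add: bij_betw_def)
    show "E u v \<longleftrightarrow> v = inv_into S p u" if u: "u \<in> S" for u v
    proof
      assume "E u v"
      with u closed pred inj show "v = inv_into S p u" by (metis inv_into_f_f)
    next
      assume v: "v = inv_into S p u"
      then have "v \<in> S" "p v = u" using u img by (auto simp: inv_into_into f_inv_into_f)
      with p show "E u v" by blast
    qed
  qed
qed

section \<open>Staircase graphs\<close>

text \<open>The positions of the ones in the block matrices: \<open>B\<close> describes the corner
  block, and the else branch covers the all-ones block and the strictly lower triangular block at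
  once.\<close>

definition stair :: "nat \<Rightarrow> (nat \<Rightarrow> nat \<Rightarrow> bool) \<Rightarrow> nat \<Rightarrow> nat \<Rightarrow> bool" where
  "stair m B i j \<longleftrightarrow> (if i < m then j < m \<and> B i j else j < i)"

text \<open>The corner blocks 1, \<open>I_2\<close> and \<open>J_2\<close>; on the indices 0 and 1,
  inequality is the 2-cycle.\<close>

definition stair_bases :: "(nat \<times> (nat \<Rightarrow> nat \<Rightarrow> bool)) set" where
  "stair_bases = {(1, (=)), (2, (=)), (2, (\<noteq>))}"

text \<open>Isomorphism of the graph induced on \<open>S\<close> with the pattern
  \<open>stair\<close>; the bound on \<open>m\<close> ensures that the base is not cut off.\<close>

definition staircase :: "('a \<Rightarrow> 'a \<Rightarrow> bool) \<Rightarrow> 'a set \<Rightarrow> nat \<Rightarrow> (nat \<Rightarrow> nat \<Rightarrow> bool) \<Rightarrow> bool" where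
  "staircase E S m B \<longleftrightarrow> m \<le> card S \<and> (\<exists>f. bij_betw f {..<card S} S \<and>
     (\<forall>i<card S. \<forall>j<card S. E (f i) (f j) \<longleftrightarrow> stair m B i j))"

text \<open>The source \<open>v\<close> receives the new largest label \<open>card S\<close>. As
  this is at least \<open>m\<close>, its row follows the lower triangular branch of
  \<open>stair\<close>.\<close>

lemma staircase_insert:
  assumes "staircase E S m B" "finite S" "v \<notin> S"
    and "{u. E v u} = S" "\<And>u. u \<in> S \<Longrightarrow> \<not> E u v"
  shows "staircase E (insert v S) m B"
proof -
  let ?n = "card S"
  obtain f where m: "m \<le> ?n" and f: "bij_betw f {..<?n} S"
    and Ef: "\<And>i j. i < ?n \<Longrightarrow> j < ?n \<Longrightarrow> E (f i) (f j) \<longleftrightarrow> stair m B i j"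
    using assms(1) unfolding staircase_def by blast
  define h where "h = f(?n := v)"
  have card: "card (insert v S) = Suc ?n" using assms(2,3) by simp
  have mem: "f i \<in> S" if "i < ?n" for i using f that by (auto simp: bij_betw_def)
  have hS: "bij_betw h {..<?n} S"
    using f by (rule bij_betw_cong[THEN iffD1, rotated]) (auto simp: h_def)
  have "bij_betw h (insert ?n {..<?n}) (insert (h ?n) S)"
    using assms(3) by (intro notIn_Un_bij_betw[of ?n "{..<?n}" h S, simplified] hS)
      (auto simp: h_def)
  then have h: "bij_betw h {..<Suc ?n} (insert v S)" by (simp add: lessThan_Suc h_def)
  have "\<not> E v v" using assms(3,4) by blast
  moreover have "E v (f j)" if "j < ?n" for j using mem[OF that] assms(4) by blast
  moreover have "\<not> E (f i) v" if "i < ?n" for i using mem[OF that] assms(5) by blast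
  ultimately have "E (h i) (h j) \<longleftrightarrow> stair m B i j" if "i < Suc ?n" "j < Suc ?n" for i j
    using that m Ef[of i j] by (auto simp: h_def stair_def less_Suc_eq)
  with m h show ?thesis unfolding staircase_def card by auto
qed

section \<open>The upper bound and its equality case\<close>

lemma less_two_power_pred:
  assumes "(n::nat) \<ge> 3"
  shows "n < 2 ^ (n - 1)"
  using assms
proof (induction n rule: nat_induct_at_least)
  case (Suc n)
  then obtain k where "n = Suc k" by (cases n) auto
  with Suc show ?case by simp
qed simp

text \<open>A permutation carries as many walks as points, so it can attain the bound only on one or
  two points, where it is a loop, two loops or a 2-cycle.\<close>

lemma small_permutation_staircase:
  assumes "finite S" "S \<noteq> {}" "card S \<le> 2"
    and g: "bij_betw g S S" "\<And>u v. u \<in> S \<Longrightarrow> E u v \<longleftrightarrow> v = g u"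
  shows "\<exists>(m, B) \<in> stair_bases. staircase E S m B"
proof -
  have "card S = 1 \<or> card S = 2"
    using assms(1-3) card_gt_0_iff[of S] by linarith
  then show ?thesis
  proof
    assume c: "card S = 1"
    then obtain v where S: "S = {v}" by (auto simp: card_1_singleton_iff)
    with g have "E v v" by (auto simp: bij_betw_def)
    moreover have "bij_betw (\<lambda>_. v) {..<1::nat} S" by (auto simp: S bij_betw_def lessThan_Suc)
    ultimately have "staircase E S 1 (=)"
      unfolding staircase_def c by (auto simp: stair_def intro!: exI[of _ "\<lambda>_. v"])
    then show ?thesis by (auto simp: stair_bases_def)
  next
    assume c: "card S = 2"
    then obtain u v where S: "S = {u, v}" "u \<noteq> v" by (auto simp: card_2_iff)
    define f where "f i = (if i = (0::nat) then u else v)" for i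
    have two: "{..<2::nat} = {0, 1}" by auto
    have f: "bij_betw f {..<2} S" using S by (auto simp: f_def two bij_betw_def)
    have gm: "g u \<in> S" "g v \<in> S" "g u \<noteq> g v"
      using g(1) S by (auto simp: bij_betw_def)
    then consider "g u = u" "g v = v" | "g u = v" "g v = u" using S by auto
    then show ?thesis
    proof cases
      case 1
      have "staircase E S 2 (=)"
        unfolding staircase_def c
        by (intro conjI exI[of _ f] f) (use 1 S g(2) in \<open>auto simp: f_def stair_def\<close>)
      then show ?thesis by (auto simp: stair_bases_def)
    next
      case 2
      have "staircase E S 2 (\<noteq>)"
        unfolding staircase_def c
        by (intro conjI exI[of _ f] f) (use 2 S g(2) in \<open>auto simp: f_def stair_def\<close>)
      then show ?thesis by (auto simp: stair_bases_def)
    qed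
  qed
qed

text \<open>Induction on \<open>card S\<close>. The clause that every vertex starts a walk is
  carried along for the equality case: only then do equal sets of walks have equal sets of
  admissible starting vertices.\<close>

lemma card_walks_bound:
  assumes "finite S" "S \<noteq> {}" "finite (walks E S)"
    and "\<And>u v. u \<in> S \<Longrightarrow> E u v \<Longrightarrow> v \<in> S"
    and extend: "\<And>x y. E x y \<Longrightarrow> \<exists>z. E y z"
  shows "card (walks E S) \<le> 2 ^ (card S - 1) \<and>
    (card (walks E S) = 2 ^ (card S - 1) \<longrightarrow>
      (\<forall>v\<in>S. walks E {v} \<noteq> {}) \<and> (\<exists>(m, B) \<in> stair_bases. staircase E S m B))"
  using assms(1-4)
proof (induction "card S" arbitrary: S rule: less_induct)
  case less
  note closed = less.prems(4)
  show ?case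
  proof (cases "\<forall>v\<in>S. \<exists>u\<in>S. E u v")
    case True
    obtain g where g: "bij_betw g S S" "\<And>u v. u \<in> S \<Longrightarrow> E u v \<longleftrightarrow> v = g u"
      by (rule sourceless_permutation[of S E, OF less.prems(1,3) closed extend])
        (use True in blast)+
    have "card (walks E S) = card S"
      using walks_unique_successor[of S E g] g by (metis bij_betw_apply bij_betw_same_card)
    moreover have "\<forall>v\<in>S. walks E {v} \<noteq> {}"
    proof
      fix v assume "v \<in> S"
      then have "E v (g v)" using g(2) by blast
      then show "walks E {v} \<noteq> {}" using extend by (rule walks_nonempty)
    qed
    moreover have "card S \<noteq> 0" using less.prems by simp
    then have "card S \<le> 2 ^ (card S - 1)"
      using less_exp[of "card S - 1"] by linarith
    moreover have "card S \<le> 2" if "card S = 2 ^ (card S - 1)"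
      using less_two_power_pred[of "card S"] that by linarith
    ultimately show ?thesis
      using small_permutation_staircase[of S g E] less.prems(1,2) g by auto
  next
    case False
    then obtain v where v: "v \<in> S" "\<And>u. u \<in> S \<Longrightarrow> \<not> E u v" by blast
    define S' where "S' = S - {v}"
    have S: "S = insert v S'" "v \<notin> S'" "finite S'" using v less.prems by (auto simp: S'_def)
    have out: "{u. E v u} \<subseteq> S'" using v closed by (auto simp: S'_def)
    have fin': "finite (walks E S')"
      using less.prems(3) walks_mono[of S' S E] S(1) by (blast intro: finite_subset)
    have finv: "finite (walks E {u. E v u})"
      using finite_subset[OF walks_mono[OF out] fin'] .
    have card: "card (walks E S) = card (walks E {u. E v u}) + card (walks E S')"
      unfolding S(1) by (rule card_walks_insert[OF S(2) fin' finv])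
    have le: "card (walks E {u. E v u}) \<le> card (walks E S')"
      by (intro card_mono fin' walks_mono out)
    have cS: "card S = Suc (card S')" using S by simp
    show ?thesis
    proof (cases "S' = {}")
      case True
      \<comment> \<open>A lone source has no successor, so there are no walks at all and the bound 1
        is strict.\<close>
      then have "walks E S' = {}" by (auto simp: walks_def)
      then show ?thesis using card le cS True by simp
    next
      case ne: False
      \<comment> \<open>Deleting \<open>v\<close> keeps the set closed, since no edge from
        \<open>S\<close> ends in \<open>v\<close>.\<close>
      have closed': "w \<in> S'" if "u \<in> S'" "E u w" for u w
        using that closed v by (auto simp: S'_def)
      have IH: "card (walks E S') \<le> 2 ^ (card S' - 1) \<and>
        (card (walks E S') = 2 ^ (card S' - 1) \<longrightarrow>
          (\<forall>v\<in>S'. walks E {v} \<noteq> {}) \<and> (\<exists>(m, B) \<in> stair_bases. staircase E S' m B))"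
        by (rule less.hyps[OF _ S(3) ne fin' closed']) (use cS in auto)
      have bound: "card (walks E S') \<le> 2 ^ (card S' - 1)" using IH by blast
      have pow: "2 ^ (card S - 1) = 2 * (2::nat) ^ (card S' - 1)"
        using ne S(3) cS by (cases "card S'") auto
      have "(\<forall>v\<in>S. walks E {v} \<noteq> {}) \<and> (\<exists>(m, B) \<in> stair_bases. staircase E S m B)"
        if eq: "card (walks E S) = 2 ^ (card S - 1)"
      proof -
        \<comment> \<open>The total is twice the bound for \<open>S'\<close>, so neither of the two
          summands can fall short of that bound.\<close>
        have eqs: "card (walks E S') = 2 ^ (card S' - 1)"
          "card (walks E {u. E v u}) = card (walks E S')"
          using eq card le bound pow by linarith+
        with IH have ne': "\<forall>v\<in>S'. walks E {v} \<noteq> {}"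
          and "\<exists>(m, B) \<in> stair_bases. staircase E S' m B" by auto
        then obtain m B where mB: "(m, B) \<in> stair_bases" "staircase E S' m B" by blast
        have "walks E {u. E v u} = walks E S'"
          using card_subset_eq[OF fin' walks_mono[OF out] eqs(2)] .
        \<comment> \<open>Each vertex of \<open>S'\<close> starts some walk; as that walk also lies
          in the left-hand set, its start is a successor of \<open>v\<close>.\<close>
        with ne' have "S' \<subseteq> {u. E v u}" by (fastforce simp: walks_def)
        with out have out': "{u. E v u} = S'" by blast
        have "staircase E S m B"
          unfolding S(1) by (rule staircase_insert[OF mB(2) S(3,2) out']) (use v S in auto)
        moreover have "walks E {v} \<noteq> {}"
          using ne ne' out' walks_nonempty[of E v] extend by blast
        ultimately show ?thesis using mB ne' S(1) by blast
      qed
      with card le bound pow show ?thesis by linarith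
    qed
  qed
qed

text \<open>Induction along the labelling: the base carries \<open>m\<close> walks, and each further
  vertex points to all earlier ones, which doubles the count.\<close>

lemma card_walks_staircase:
  assumes "staircase E S m B" "(m, B) \<in> stair_bases" and "finite S"
    and closed: "\<And>u v. u \<in> S \<Longrightarrow> E u v \<Longrightarrow> v \<in> S"
  shows "card (walks E S) = 2 ^ (card S - 1)"
proof -
  obtain f where m: "m \<le> card S" and f: "bij_betw f {..<card S} S"
    and Ef: "\<And>i j. i < card S \<Longrightarrow> j < card S \<Longrightarrow> E (f i) (f j) \<longleftrightarrow> stair m B i j"
    using assms(1) unfolding staircase_def by blast
  have fS: "f ` {..<card S} = S" and inj: "inj_on f {..<card S}"
    using f by (auto simp: bij_betw_def)
  have out: "{v. E (f i) v} = f ` {j. j < card S \<and> stair m B i j}" if "i < card S" for i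
  proof (intro equalityI subsetI)
    fix v assume "v \<in> {v. E (f i) v}"
    then have v: "E (f i) v" by simp
    with closed fS that have "v \<in> f ` {..<card S}" by blast
    then obtain j where "j < card S" "v = f j" by blast
    with v Ef[of i j] that show "v \<in> f ` {j. j < card S \<and> stair m B i j}" by blast
  qed (use Ef that in auto)
  have mpos: "m = 1 \<or> m = 2" using assms(2) by (auto simp: stair_bases_def)
  \<comment> \<open>Each base relation is the graph of a function on the indices below
    \<open>m\<close>; below, \<open>g\<close> transports it along \<open>f\<close>.\<close>
  obtain s where s: "\<And>i. i < m \<Longrightarrow> s i < m \<and> (\<forall>j<m. B i j \<longleftrightarrow> j = s i)"
  proof -
    have "\<forall>i<m. \<exists>k<m. \<forall>j<m. B i j \<longleftrightarrow> j = k"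
      using assms(2) by (auto simp: stair_bases_def less_2_cases_iff)
    then show thesis using that by metis
  qed
  have "finite (walks E (f ` {..<n})) \<and> card (walks E (f ` {..<n})) = 2 ^ (n - 1)"
    if "m \<le> n" "n \<le> card S" for n
    using that
  proof (induction n rule: nat_induct_at_least)
    case base
    define g where "g = (\<lambda>x. f (s (inv_into {..<card S} f x)))"
    have g: "g (f i) = f (s i)" if "i < m" for i
      using that m inj by (simp add: g_def)
    have outm: "{v. E (f i) v} = {f (s i)}" if "i < m" for i
      using that m s[OF that] by (subst out) (auto simp: stair_def)
    have "bij_betw (\<lambda>v k. (g ^^ k) v) (f ` {..<m}) (walks E (f ` {..<m}))"
      by (rule walks_unique_successor) (use outm g s in fastforce)+
    then have "finite (walks E (f ` {..<m}))" "card (walks E (f ` {..<m})) = card (f ` {..<m})"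
      using bij_betw_finite bij_betw_same_card by fastforce+
    moreover have "card (f ` {..<m}) = m"
      using inj m by (subst card_image) (auto intro: inj_on_subset)
    \<comment> \<open>Here \<open>m = 2 ^ (m - 1)\<close>, because \<open>m\<close> is 1 or
      2.\<close>
    ultimately show ?case using mpos by auto
  next
    case (Suc n)
    have outn: "{v. E (f n) v} = f ` {..<n}"
      using Suc by (subst out) (auto simp: stair_def intro!: arg_cong[of _ _ "image f"])
    have notin: "f n \<notin> f ` {..<n}"
      using Suc inj by (auto dest: inj_onD)
    have fin: "finite (walks E (f ` {..<n}))" and c: "card (walks E (f ` {..<n})) = 2 ^ (n - 1)"
      using Suc by auto
    have "card (walks E (insert (f n) (f ` {..<n}))) = 2 * 2 ^ (n - 1)"
      using card_walks_insert[OF notin fin] fin c unfolding outn by simp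
    moreover have "finite (walks E (insert (f n) (f ` {..<n})))"
      by (subst walks_insert) (simp add: fin finite_walks_singleton outn)
    moreover have "n \<ge> 1" using Suc mpos by auto
    then have "2 * 2 ^ (n - 1) = (2::nat) ^ (Suc n - 1)" by (cases n) auto
    ultimately show ?case by (simp add: lessThan_Suc)
  qed
  from this[OF m] show ?thesis unfolding fS by simp
qed

section \<open>Simultaneous row and column permutations\<close>

text \<open>The head of the list is applied last, matching the action of the product of swap
  matrices on column indices by right multiplication.\<close>

primrec swaps :: "(nat \<times> nat) list \<Rightarrow> nat \<Rightarrow> nat" where
  "swaps [] = id"
| "swaps (p # ps) = transpose (fst p) (snd p) \<circ> swaps ps"

lemma swap_mat_carrier [simp]: "swap_mat b p \<in> carrier_mat b b"
  by (cases p) (simp add: swap_mat_def)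

lemma mat_list_prod_carrier: "set Qs \<subseteq> carrier_mat b b \<Longrightarrow> mat_list_prod b Qs \<in> carrier_mat b b"
  by (induction Qs) (auto simp: mat_list_prod_def)

lemma mat_list_prod_snoc:
  assumes "set Qs \<subseteq> carrier_mat b b" "Q \<in> carrier_mat b b"
  shows "mat_list_prod b (Qs @ [Q]) = mat_list_prod b Qs * Q"
  using assms
proof (induction Qs)
  case Nil then show ?case by (simp add: mat_list_prod_def)
next
  case (Cons P Qs)
  then show ?case
    using assoc_mult_mat[of P b b "mat_list_prod b Qs" b Q b] mat_list_prod_carrier[of Qs b]
    by (simp add: mat_list_prod_def)
qed

lemma swap_mat_index:
  assumes "i < b" "j < b" "a < b" "c < b"
  shows "swap_mat b (i, j) $$ (a, c) = (if transpose i j a = c then 1 else 0)"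
  using assms by (auto simp: swap_mat_def transpose_def)

lemma transpose_less: "i < b \<Longrightarrow> j < b \<Longrightarrow> a < b \<Longrightarrow> transpose i j a < (b::nat)"
  by (simp add: transpose_def)

lemma swap_mat_mult:
  assumes "X \<in> carrier_mat b b" "i < b" "j < b"
  shows "swap_mat b (i, j) * X = mat b b (\<lambda>(a, c). X $$ (transpose i j a, c))" (is ?L)
    and "X * swap_mat b (i, j) = mat b b (\<lambda>(a, c). X $$ (a, transpose i j c))" (is ?R)
proof -
  have dim: "dim_row (swap_mat b (i, j)) = b" "dim_col (swap_mat b (i, j)) = b"
    by (fact carrier_matD[OF swap_mat_carrier])+
  show ?L
  proof (rule eq_matI)
    fix a c assume "a < dim_row (mat b b (\<lambda>(a, c). X $$ (transpose i j a, c)))"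
      "c < dim_col (mat b b (\<lambda>(a, c). X $$ (transpose i j a, c)))"
    then have ac: "a < b" "c < b" by auto
    have "(swap_mat b (i, j) * X) $$ (a, c)
        = (\<Sum>k = 0..<b. (if transpose i j a = k then 1 else 0) * X $$ (k, c))"
      using assms ac dim by (simp add: scalar_prod_def swap_mat_index)
    also have "\<dots> = (\<Sum>k = 0..<b. if transpose i j a = k then X $$ (k, c) else 0)"
      by (intro sum.cong) auto
    also have "\<dots> = X $$ (transpose i j a, c)"
      using transpose_less[OF assms(2,3) ac(1)] by simp
    finally show "(swap_mat b (i, j) * X) $$ (a, c)
        = mat b b (\<lambda>(a, c). X $$ (transpose i j a, c)) $$ (a, c)" using ac by simp
  qed (use assms dim in auto)
  show ?R
  proof (rule eq_matI)
    fix a c assume "a < dim_row (mat b b (\<lambda>(a, c). X $$ (a, transpose i j c)))"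
      "c < dim_col (mat b b (\<lambda>(a, c). X $$ (a, transpose i j c)))"
    then have ac: "a < b" "c < b" by auto
    have "(X * swap_mat b (i, j)) $$ (a, c)
        = (\<Sum>k = 0..<b. X $$ (a, k) * (if transpose i j k = c then 1 else 0))"
      using assms ac dim by (simp add: scalar_prod_def swap_mat_index)
    \<comment> \<open>A transposition is its own inverse, so it can be moved from \<open>k\<close>
      to \<open>c\<close>.\<close>
    also have "\<dots> = (\<Sum>k = 0..<b. if transpose i j c = k then X $$ (a, k) else 0)"
      by (intro sum.cong) auto
    also have "\<dots> = X $$ (a, transpose i j c)"
      using transpose_less[OF assms(2,3) ac(2)] by simp
    finally show "(X * swap_mat b (i, j)) $$ (a, c)
        = mat b b (\<lambda>(a, c). X $$ (a, transpose i j c)) $$ (a, c)" using ac by simp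
  qed (use assms dim in auto)
qed

lemma swaps_permutes:
  "set ps \<subseteq> {..<b} \<times> {..<b} \<Longrightarrow> swaps ps permutes {..<b}"
proof (induction ps)
  case (Cons p ps)
  then show ?case
    by (cases p) (auto simp del: o_apply intro!: permutes_compose permutes_swap_id)
qed (simp add: permutes_id)

text \<open>Transpositions generate all permutations of a finite set, so equivalence allows every
  simultaneous relabelling.\<close>

lemma permutes_swaps:
  assumes "\<pi> permutes {..<b}"
  shows "\<exists>ps. set ps \<subseteq> {..<b} \<times> {..<b} \<and> swaps ps = \<pi>"
proof (rule permutes_induct[OF assms finite_lessThan])
  show "\<exists>ps. set ps \<subseteq> {..<b} \<times> {..<b} \<and> swaps ps = id"
    by (intro exI[of _ "[]"]) auto
next
  fix i j p assume ij: "i \<in> {..<b}" "j \<in> {..<b}"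
    and "\<exists>ps. set ps \<subseteq> {..<b} \<times> {..<b} \<and> swaps ps = p"
  then obtain ps where "set ps \<subseteq> {..<b} \<times> {..<b}" "swaps ps = p" by blast
  with ij show "\<exists>ps. set ps \<subseteq> {..<b} \<times> {..<b} \<and> swaps ps = transpose i j \<circ> p"
    by (intro exI[of _ "(i, j) # ps"]) auto
qed

lemma swaps_less: "set ps \<subseteq> {..<b} \<times> {..<b} \<Longrightarrow> a < b \<Longrightarrow> swaps ps a < b"
  using permutes_in_image[OF swaps_permutes] by fastforce

lemma mult_swaps_right:
  assumes "X \<in> carrier_mat b b" "set ps \<subseteq> {..<b} \<times> {..<b}"
  shows "X * mat_list_prod b (map (swap_mat b) ps) = mat b b (\<lambda>(a, c). X $$ (a, swaps ps c))"
  using assms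
proof (induction ps arbitrary: X)
  case Nil
  then show ?case by (auto simp: mat_list_prod_def)
next
  case (Cons p ps)
  obtain i j where p: "p = (i, j)" "i < b" "j < b" using Cons.prems by (cases p) auto
  let ?P = "mat_list_prod b (map (swap_mat b) ps)"
  have P: "?P \<in> carrier_mat b b" by (intro mat_list_prod_carrier) auto
  have "X * mat_list_prod b (map (swap_mat b) (p # ps)) = (X * swap_mat b p) * ?P"
    using Cons.prems P by (simp add: mat_list_prod_def assoc_mult_mat[of X b b "swap_mat b p" b _ b])
  also have "\<dots> = mat b b (\<lambda>(a, c). (X * swap_mat b p) $$ (a, swaps ps c))"
    using Cons.prems by (intro Cons.IH mult_carrier_mat[of _ b b]) auto
  also have "\<dots> = mat b b (\<lambda>(a, c). X $$ (a, swaps (p # ps) c))"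
    using Cons.prems p swaps_less[of ps b]
    by (intro eq_matI) (auto simp: swap_mat_mult(2))
  finally show ?case .
qed

text \<open>Reversal puts the head factor next to \<open>X\<close>, so rows undergo the same
  substitution \<open>swaps ps\<close> as columns do under right multiplication.\<close>

lemma mult_swaps_left:
  assumes "X \<in> carrier_mat b b" "set ps \<subseteq> {..<b} \<times> {..<b}"
  shows "mat_list_prod b (map (swap_mat b) (rev ps)) * X = mat b b (\<lambda>(a, c). X $$ (swaps ps a, c))"
  using assms
proof (induction ps arbitrary: X)
  case Nil
  then show ?case by (auto simp: mat_list_prod_def)
next
  case (Cons p ps)
  obtain i j where p: "p = (i, j)" "i < b" "j < b" using Cons.prems by (cases p) auto
  let ?P = "mat_list_prod b (map (swap_mat b) (rev ps))"
  have P: "?P \<in> carrier_mat b b" by (intro mat_list_prod_carrier) auto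
  have "mat_list_prod b (map (swap_mat b) (rev (p # ps))) = ?P * swap_mat b p"
    using mat_list_prod_snoc[of "map (swap_mat b) (rev ps)" b "swap_mat b p"] swap_mat_carrier
    by (simp add: image_subset_iff)
  then have "mat_list_prod b (map (swap_mat b) (rev (p # ps))) * X = ?P * (swap_mat b p * X)"
    using Cons.prems P by (simp add: assoc_mult_mat[of _ b b "swap_mat b p" b X b])
  also have "\<dots> = mat b b (\<lambda>(a, c). (swap_mat b p * X) $$ (swaps ps a, c))"
    using Cons.prems by (intro Cons.IH mult_carrier_mat[of _ b b]) auto
  also have "\<dots> = mat b b (\<lambda>(a, c). X $$ (swaps (p # ps) a, c))"
    using Cons.prems p swaps_less[of ps b]
    by (intro eq_matI) (auto simp: swap_mat_mult(1))
  finally show ?case .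
qed

lemma conjugate_swaps:
  assumes "X \<in> carrier_mat b b" "set ps \<subseteq> {..<b} \<times> {..<b}"
  shows "mat_list_prod b (map (swap_mat b) (rev ps)) * X * mat_list_prod b (map (swap_mat b) ps)
    = mat b b (\<lambda>(a, c). X $$ (swaps ps a, swaps ps c))"
  using assms swaps_less[OF assms(2)]
  by (subst mult_swaps_left) (auto simp: mult_swaps_right)

text \<open>Equivalence is isomorphism of labelled structures. Conjugation expresses
  \<open>M\<close> through \<open>N\<close> by a permutation, and \<open>f\<close> is the inverse of
  that permutation.\<close>

lemma mat_equiv_iff:
  assumes M: "M \<in> zero_one_mats b" and N: "N \<in> zero_one_mats b"
  shows "mat_equiv b M N \<longleftrightarrow>
    (\<exists>f. bij_betw f {..<b} {..<b} \<and> (\<forall>i<b. \<forall>j<b. M $$ (f i, f j) = N $$ (i, j)))"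
proof -
  have car: "M \<in> carrier_mat b b" "N \<in> carrier_mat b b"
    using M N by (auto simp: zero_one_mats_def)
  have "mat_equiv b M N \<longleftrightarrow>
      (\<exists>ps. set ps \<subseteq> {..<b} \<times> {..<b} \<and> M = mat b b (\<lambda>(a, c). N $$ (swaps ps a, swaps ps c)))"
    using M N conjugate_swaps[OF car(2)]
    by (auto simp: mat_equiv_def alphabet_def atLeast0LessThan)
  also have "\<dots> \<longleftrightarrow>
      (\<exists>\<pi>. \<pi> permutes {..<b} \<and> M = mat b b (\<lambda>(a, c). N $$ (\<pi> a, \<pi> c)))"
    using swaps_permutes permutes_swaps by metis
  also have "\<dots> \<longleftrightarrow>
    (\<exists>f. bij_betw f {..<b} {..<b} \<and> (\<forall>i<b. \<forall>j<b. M $$ (f i, f j) = N $$ (i, j)))"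
  proof
    assume "\<exists>\<pi>. \<pi> permutes {..<b} \<and> M = mat b b (\<lambda>(a, c). N $$ (\<pi> a, \<pi> c))"
    then obtain \<pi> where \<pi>: "\<pi> permutes {..<b}" "M = mat b b (\<lambda>(a, c). N $$ (\<pi> a, \<pi> c))" by blast
    have inv: "inv_into UNIV \<pi> permutes {..<b}" using permutes_inv[OF \<pi>(1)] .
    have "M $$ (inv_into UNIV \<pi> i, inv_into UNIV \<pi> j) = N $$ (i, j)" if "i < b" "j < b" for i j
      using that permutes_in_image[OF inv] permutes_inverses(1)[OF \<pi>(1)] \<pi>(2) by simp
    then show "\<exists>f. bij_betw f {..<b} {..<b} \<and> (\<forall>i<b. \<forall>j<b. M $$ (f i, f j) = N $$ (i, j))"
      using permutes_imp_bij[OF inv] by blast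
  next
    assume "\<exists>f. bij_betw f {..<b} {..<b} \<and> (\<forall>i<b. \<forall>j<b. M $$ (f i, f j) = N $$ (i, j))"
    then obtain f where f: "bij_betw f {..<b} {..<b}"
      and MN: "\<And>i j. i < b \<Longrightarrow> j < b \<Longrightarrow> M $$ (f i, f j) = N $$ (i, j)" by blast
    \<comment> \<open>\<open>f\<close> is arbitrary outside the index range, so it is extended by
      the identity to obtain a permutation of all naturals.\<close>
    define h where "h x = (if x < b then f x else x)" for x
    have h: "h permutes {..<b}"
    proof (rule bij_imp_permutes)
      show "bij_betw h {..<b} {..<b}"
        using f by (rule bij_betw_cong[THEN iffD1, rotated]) (simp add: h_def)
    qed (simp add: h_def)
    have inv: "inv_into UNIV h permutes {..<b}" using permutes_inv[OF h] .
    have "M $$ (a, c) = N $$ (inv_into UNIV h a, inv_into UNIV h c)" if "a < b" "c < b" for a c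
    proof -
      have less: "inv_into UNIV h a < b" "inv_into UNIV h c < b" using that permutes_in_image[OF inv] by auto
      then have "f (inv_into UNIV h a) = a" "f (inv_into UNIV h c) = c"
        using permutes_inverses(1)[OF h] by (metis h_def)+
      then show ?thesis using MN[OF less] by simp
    qed
    then have "M = mat b b (\<lambda>(a, c). N $$ (inv_into UNIV h a, inv_into UNIV h c))"
      using car by (intro eq_matI) auto
    with inv show "\<exists>\<pi>. \<pi> permutes {..<b} \<and> M = mat b b (\<lambda>(a, c). N $$ (\<pi> a, \<pi> c))" by blast
  qed
  finally show ?thesis .
qed

section \<open>The extremal matrices\<close>

definition stair_mat :: "nat \<Rightarrow> nat \<Rightarrow> (nat \<Rightarrow> nat \<Rightarrow> bool) \<Rightarrow> int mat" where
  "stair_mat b m B = mat b b (\<lambda>(i, j). if stair m B i j then 1 else 0)"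

lemma four_block_stair_mat:
  assumes "m \<le> b" "C \<in> carrier_mat m m"
    and "\<And>i j. i < m \<Longrightarrow> j < m \<Longrightarrow> C $$ (i, j) = (if B i j then 1 else 0)"
  shows "four_block_mat C (0\<^sub>m m (b - m)) (ones_mat (b - m) m) (L_mat (b - m)) = stair_mat b m B"
  using assms by (intro eq_matI) (auto simp: stair_mat_def stair_def ones_mat_def L_mat_def)

lemma stair_mat_zero_one:
  assumes "(m, B) \<in> stair_bases" "m \<le> b"
  shows "stair_mat b m B \<in> zero_one_mats b"
proof -
  \<comment> \<open>Row 0 witnesses that the matrix is nonzero: its 1 is on the diagonal for a loop
    and in column 1 for the 2-cycle.\<close>
  have "\<exists>j<b. stair_mat b m B $$ (0, j) = 1"
  proof (cases "B 0 0")
    case True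
    then show ?thesis using assms by (intro exI[of _ 0]) (auto simp: stair_bases_def stair_mat_def stair_def)
  next
    case False
    then show ?thesis using assms by (intro exI[of _ 1]) (auto simp: stair_bases_def stair_mat_def stair_def)
  qed
  moreover have "b > 0" using assms by (auto simp: stair_bases_def)
  ultimately have "stair_mat b m B \<noteq> 0\<^sub>m b b" by auto
  then show ?thesis by (auto simp: zero_one_mats_def stair_mat_def)
qed

text \<open>The bounds exclude unspecified entries outside the matrix and make \<open>{..<b}\<close>
  closed under successors.\<close>

definition edge :: "nat \<Rightarrow> int mat \<Rightarrow> nat \<Rightarrow> nat \<Rightarrow> bool" where
  "edge b M i j \<longleftrightarrow> i < b \<and> j < b \<and> M $$ (i, j) = 1"

lemma admissible_words_eq_walks:
  "admissible_words b M = walks (edge b M) {..<b}"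
  by (auto simp: admissible_words_def infinite_words_def alphabet_def walks_def edge_def)

lemma mat_equiv_stair_mat:
  assumes "M \<in> zero_one_mats b" "(m, B) \<in> stair_bases" "m \<le> b"
  shows "mat_equiv b M (stair_mat b m B) \<longleftrightarrow> staircase (edge b M) {..<b} m B"
proof -
  have "(\<forall>i<b. \<forall>j<b. M $$ (f i, f j) = stair_mat b m B $$ (i, j)) \<longleftrightarrow>
      (\<forall>i<b. \<forall>j<b. edge b M (f i) (f j) \<longleftrightarrow> stair m B i j)"
    if "bij_betw f {..<b} {..<b}" for f
  proof -
    have less: "f i < b" if "i < b" for i
      using bij_betw_apply[OF \<open>bij_betw f {..<b} {..<b}\<close>, of i] that by simp
    have "M $$ (f i, f j) = 0 \<or> M $$ (f i, f j) = 1" if "i < b" "j < b" for i j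
      using assms(1) less that by (auto simp: zero_one_mats_def)
    then have "M $$ (f i, f j) = stair_mat b m B $$ (i, j) \<longleftrightarrow>
        (edge b M (f i) (f j) \<longleftrightarrow> stair m B i j)" if "i < b" "j < b" for i j
      using less that by (force simp: stair_mat_def edge_def)
    then show ?thesis by simp
  qed
  then show ?thesis
    unfolding mat_equiv_iff[OF assms(1) stair_mat_zero_one[OF assms(2,3)]] staircase_def
    using assms(3) by auto
qed

text \<open>Condition \<open>P1\<close> in graph form: an edge into \<open>j\<close> makes column
  \<open>j\<close> nonzero, hence row \<open>j\<close> is nonzero. This supplies the hypothesis
  \<open>extend\<close> of the bound.\<close>

lemma edge_extend:
  assumes "M \<in> zero_one_mats_P1 b" "edge b M i j"
  shows "\<exists>k. edge b M j k"
proof -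
  have M: "M \<in> carrier_mat b b" "\<And>k. k < b \<Longrightarrow> M $$ (j, k) \<in> {0, 1}" and "P1 b M"
    and ij: "i < b" "j < b" "M $$ (i, j) = 1"
    using assms by (auto simp: zero_one_mats_P1_def zero_one_mats_def edge_def)
  have "col M j $ i = 1" using M ij by simp
  then have "col M j \<noteq> 0\<^sub>v b" using ij by auto
  then have "row M j \<noteq> 0\<^sub>v b" using \<open>P1 b M\<close> ij by (auto simp: P1_def alphabet_def)
  then obtain k where "k < b" "M $$ (j, k) \<noteq> 0"
    using M ij by (auto simp: vec_eq_iff)
  then show ?thesis using M(2)[of k] ij by (auto simp: edge_def)
qed

theorem corollary2:
  fixes b :: nat and M :: "int mat"
  assumes "b \<ge> 2"
    and "M \<in> zero_one_mats_P1 b"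
  shows "card (admissible_words b M) = 2 ^ (b - 1) \<longleftrightarrow>
      mat_equiv b M
        (four_block_mat (1\<^sub>m 1) (0\<^sub>m 1 (b - 1)) (ones_mat (b - 1) 1) (L_mat (b - 1)))
    \<or> mat_equiv b M
        (four_block_mat (1\<^sub>m 2) (0\<^sub>m 2 (b - 2)) (ones_mat (b - 2) 2) (L_mat (b - 2)))
    \<or> mat_equiv b M
        (four_block_mat J2_mat (0\<^sub>m 2 (b - 2)) (ones_mat (b - 2) 2) (L_mat (b - 2)))"
proof -
  let ?E = "edge b M"
  have M: "M \<in> zero_one_mats b" using assms(2) by (simp add: zero_one_mats_P1_def)
  have closed: "\<And>u v. u \<in> {..<b} \<Longrightarrow> ?E u v \<Longrightarrow> v \<in> {..<b}" by (simp add: edge_def)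
  have J2: "J2_mat \<in> carrier_mat 2 2"
    "\<And>i j. i < 2 \<Longrightarrow> j < 2 \<Longrightarrow> J2_mat $$ (i, j) = (if i \<noteq> j then 1 else 0)"
    by (auto simp: J2_mat_def mat_of_rows_list_def less_2_cases_iff)
  have blocks:
    "four_block_mat (1\<^sub>m 1) (0\<^sub>m 1 (b - 1)) (ones_mat (b - 1) 1) (L_mat (b - 1))
      = stair_mat b 1 (=)"
    "four_block_mat (1\<^sub>m 2) (0\<^sub>m 2 (b - 2)) (ones_mat (b - 2) 2) (L_mat (b - 2))
      = stair_mat b 2 (=)"
    "four_block_mat J2_mat (0\<^sub>m 2 (b - 2)) (ones_mat (b - 2) 2) (L_mat (b - 2))
      = stair_mat b 2 (\<noteq>)"
    using assms(1) J2 by (intro four_block_stair_mat; simp)+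
  have "card (walks ?E {..<b}) = 2 ^ (b - 1) \<longleftrightarrow>
      (\<exists>(m, B) \<in> stair_bases. staircase ?E {..<b} m B)"
  proof
    assume c: "card (walks ?E {..<b}) = 2 ^ (b - 1)"
    \<comment> \<open>Infinite sets have \<open>card\<close> equal to 0, so a positive value forces
      finiteness.\<close>
    then have "finite (walks ?E {..<b})" by (intro card_ge_0_finite) simp
    then show "\<exists>(m, B) \<in> stair_bases. staircase ?E {..<b} m B"
      using card_walks_bound[of "{..<b}" ?E] c closed edge_extend[OF assms(2)] assms(1)
      by (auto simp: lessThan_empty_iff)
  next
    assume "\<exists>(m, B) \<in> stair_bases. staircase ?E {..<b} m B"
    then obtain m B where "(m, B) \<in> stair_bases" "staircase ?E {..<b} m B" by blast
    with card_walks_staircase[of ?E "{..<b}" m B] closed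
    show "card (walks ?E {..<b}) = 2 ^ (b - 1)" by simp
  qed
  then show ?thesis
    unfolding blocks admissible_words_eq_walks
    using assms(1) M by (simp add: mat_equiv_stair_mat stair_bases_def)
qed

end
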